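(* For each $n\ge 1$ let $\rho_n$, $\gamma_n$ and $\pi_n$ be random permutations in $S_n$ with the inverse-unfair, the unfair and the uniform distribution, respectively, and let $\mathcal{L}(\cdot)$ denote the law of a random permutation. Then $$\lim_{n\to\infty} d_{TV}(\mathcal{L}(\rho_n),\mathcal{L}(\pi_n)) = 1,$$ and likewise $$\lim_{n\to\infty} d_{TV}(\mathcal{L}(\gamma_n),\mathcal{L}(\pi_n)) = 1.$$
   Context: $S_n$ is the symmetric group on $\{1,\dots,n\}$. Let $\{X^{(i)}_j : 1\le i\le n,\ 1\le j\le i\}$ be independent random variables, each uniform on $(0,1)$, and set $Z_i=\max\{X^{(i)}_1,\dots,X^{(i)}_i\}$ for $i=1,\dots,n$ (so the $Z_i$ are independent and almost surely distinct). Let $R_i$ be the rank of $Z_i$ among $Z_1,\dots,Z_n$, where rank $1$ is the smallest value. The inverse-unfair permutation is $\rho_n=(R_1,\dots,R_n)$, i.e. $\rho_n(i)=R_i$. The unfair permutation is $\gamma_n=\rho_n^{-1}$, i.e. $\gamma_n(i)$ is the index $j$ such that $Z_j$ is the $i$-th smallest value. For probability measures $\mu,\nu$ on a finite set $\mathcal S$, $d_{TV}(\mu,\nu)=\sup_{A\subset\mathcal S}|\mu(A)-\nu(A)|=\frac12\sum_{x\in\mathcal S}|\mu(x)-\nu(x)|$. *)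

theory Defs
  imports "HOL-Probability.Probability" "HOL-Combinatorics.Permutations"
begin

definition unit_uniform :: "real measure" where
  "unit_uniform = uniform_measure lborel {0<..<1}"

definition array_index :: "nat \<Rightarrow> (nat \<times> nat) set" where
  "array_index n = (SIGMA i:{1..n}. {1..i})"

definition score :: "(nat \<times> nat \<Rightarrow> real) \<Rightarrow> nat \<Rightarrow> real" where
  "score x i = Max ((\<lambda>j. x (i, j)) ` {1..i})"

definition rank_among :: "nat \<Rightarrow> (nat \<Rightarrow> real) \<Rightarrow> nat \<Rightarrow> nat" where
  "rank_among n z i = card {j \<in> {1..n}. z j \<le> z i}"

text \<open>Elements of the symmetric group on \<open>{1..n}\<close> are functions that permute \<open>{1..n}\<close>, hence
  fix every other number. If two scores tie, which has probability 0, the value below is not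
  a permutation; laws are therefore measures on all functions \<open>nat \<Rightarrow> nat\<close>.\<close>

definition inverse_unfair_perm :: "nat \<Rightarrow> (nat \<times> nat \<Rightarrow> real) \<Rightarrow> nat \<Rightarrow> nat" where
  "inverse_unfair_perm n x = (\<lambda>i. if i \<in> {1..n} then rank_among n (score x) i else i)"

definition unfair_perm :: "nat \<Rightarrow> (nat \<times> nat \<Rightarrow> real) \<Rightarrow> nat \<Rightarrow> nat" where
  "unfair_perm n x = inv (inverse_unfair_perm n x)"

definition law :: "'a measure \<Rightarrow> ('a \<Rightarrow> nat \<Rightarrow> nat) \<Rightarrow> (nat \<Rightarrow> nat) measure" where
  "law M f = distr M (count_space UNIV) f"

text \<open>The independent uniform array is realised as the identity on the product space; any other
  realisation gives the same laws, see \<open>law_inverse_unfair_perm\<close> and \<open>law_unfair_perm\<close> below.\<close>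

definition array_measure :: "nat \<Rightarrow> (nat \<times> nat \<Rightarrow> real) measure" where
  "array_measure n = (\<Pi>\<^sub>M p\<in>array_index n. unit_uniform)"

definition inverse_unfair_law :: "nat \<Rightarrow> (nat \<Rightarrow> nat) measure" where
  "inverse_unfair_law n = law (array_measure n) (inverse_unfair_perm n)"

definition unfair_law :: "nat \<Rightarrow> (nat \<Rightarrow> nat) measure" where
  "unfair_law n = law (array_measure n) (unfair_perm n)"

definition sym_group :: "nat \<Rightarrow> (nat \<Rightarrow> nat) set" where
  "sym_group n = {p. p permutes {1..n}}"

definition uniform_law :: "nat \<Rightarrow> (nat \<Rightarrow> nat) measure" where
  "uniform_law n = measure_pmf (pmf_of_set (sym_group n))"

definition has_law :: "'a measure \<Rightarrow> ('a \<Rightarrow> nat \<Rightarrow> nat) \<Rightarrow> (nat \<Rightarrow> nat) measure \<Rightarrow> bool" where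
  "has_law M f \<mu> \<longleftrightarrow>
     prob_space M \<and> f \<in> measurable M (count_space UNIV) \<and> law M f = \<mu>"

definition tv_dist :: "'a set \<Rightarrow> 'a measure \<Rightarrow> 'a measure \<Rightarrow> real" where
  "tv_dist S \<mu> \<nu> = (SUP A\<in>Pow S. \<bar>measure \<mu> A - measure \<nu> A\<bar>)"

definition uniform_array :: "nat \<Rightarrow> 'a measure \<Rightarrow> (nat \<Rightarrow> nat \<Rightarrow> 'a \<Rightarrow> real) \<Rightarrow> bool" where
  "uniform_array n M X \<longleftrightarrow>
     prob_space M \<and>
     prob_space.indep_vars M (\<lambda>_. borel) (\<lambda>(i, j). X i j) (array_index n) \<and>
     (\<forall>i\<in>{1..n}. \<forall>j\<in>{1..i}. distr M borel (X i j) = unit_uniform)"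

lemma sets_unit_uniform [measurable_cong, simp]: "sets unit_uniform = sets borel"
  by (simp add: unit_uniform_def)

lemma space_unit_uniform [simp]: "space unit_uniform = UNIV"
  by (simp add: unit_uniform_def)

lemma prob_space_unit_uniform: "prob_space unit_uniform"
  unfolding unit_uniform_def by (rule prob_space_uniform_measure) auto

lemma finite_array_index: "finite (array_index n)"
  by (simp add: array_index_def)

lemma measurable_score:
  assumes "i \<in> {1..n}"
  shows "(\<lambda>x. score x i) \<in> borel_measurable (array_measure n)"
proof -
  have "(\<lambda>x. Max ((\<lambda>j. x (i, j)) ` {1..i})) \<in> borel_measurable (array_measure n)"
  proof (rule borel_measurable_Max)
    fix j assume "j \<in> {1..i}"
    then have "(i, j) \<in> array_index n" using assms by (auto simp: array_index_def)
    then have "(\<lambda>x. x (i, j)) \<in> measurable (array_measure n) unit_uniform"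
      unfolding array_measure_def by (rule measurable_component_singleton)
    then show "(\<lambda>x. x (i, j)) \<in> borel_measurable (array_measure n)"
      using measurable_cong_sets[OF refl sets_unit_uniform] by blast
  qed auto
  then show ?thesis by (simp add: score_def)
qed

lemma inverse_unfair_perm_eq_on:
  "inverse_unfair_perm n x = (\<lambda>i. if i \<in> {1..n} then
     card {j \<in> {1..n}. (j, i) \<in> {(j, i). j \<in> {1..n} \<and> i \<in> {1..n} \<and> score x j \<le> score x i}} else i)"
  unfolding inverse_unfair_perm_def rank_among_def by (intro ext) (auto intro!: arg_cong[where f=card])

lemma measurable_inverse_unfair_perm:
  "inverse_unfair_perm n \<in> measurable (array_measure n) (count_space UNIV)"
proof -
  let ?R = "\<lambda>x. {(j, i). j \<in> {1..n} \<and> i \<in> {1..n} \<and> score x j \<le> score x i}"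
  let ?T = "Pow ({1..n} \<times> {1..n})"
  have "?R \<in> measurable (array_measure n) (count_space ?T)"
  proof (subst measurable_count_space_eq2, simp, intro conjI ballI)
    show "?R \<in> space (array_measure n) \<rightarrow> ?T" by auto
    fix r assume r: "r \<in> ?T"
    have eq: "?R -` {r} \<inter> space (array_measure n) =
      {x \<in> space (array_measure n). \<forall>i\<in>{1..n}. \<forall>j\<in>{1..n}. (score x j \<le> score x i) = ((j, i) \<in> r)}"
    proof (intro equalityI subsetI)
      fix x
      assume "x \<in> {x \<in> space (array_measure n). \<forall>i\<in>{1..n}. \<forall>j\<in>{1..n}. (score x j \<le> score x i) = ((j, i) \<in> r)}"
      then have "x \<in> space (array_measure n)" and
        h: "\<And>i j. i \<in> {1..n} \<Longrightarrow> j \<in> {1..n} \<Longrightarrow> (score x j \<le> score x i) = ((j, i) \<in> r)"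
        by blast+
      have mem: "(j, i) \<in> r \<Longrightarrow> j \<in> {1..n} \<and> i \<in> {1..n}" for i j
        using r by blast
      have "?R x = r"
      proof (rule set_eqI)
        fix p :: "nat \<times> nat"
        obtain j i where p: "p = (j, i)" by (cases p)
        show "p \<in> ?R x \<longleftrightarrow> p \<in> r"
          unfolding p mem_Collect_eq prod.case using h[of i j] mem[of j i] by metis
      qed
      with \<open>x \<in> space (array_measure n)\<close> show "x \<in> ?R -` {r} \<inter> space (array_measure n)" by (simp only: vimage_eq Int_iff singleton_iff)
    qed auto
    show "?R -` {r} \<inter> space (array_measure n) \<in> sets (array_measure n)"
      unfolding eq
    proof (intro sets.sets_Collect_finite_All)
      fix i j assume ij: "i \<in> {1..n}" "j \<in> {1..n}"
      have "{x \<in> space (array_measure n). score x j \<le> score x i} \<in> sets (array_measure n)"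
        using ij by (intro borel_measurable_le measurable_score)
      moreover have "{x \<in> space (array_measure n). \<not> score x j \<le> score x i} \<in> sets (array_measure n)"
        using ij unfolding not_le by (intro borel_measurable_less measurable_score)
      ultimately show "{x \<in> space (array_measure n). (score x j \<le> score x i) = ((j, i) \<in> r)} \<in> sets (array_measure n)"
        by (cases "(j, i) \<in> r") simp_all
    qed auto
  qed
  then have "(\<lambda>x. (\<lambda>r i. if i \<in> {1..n} then card {j \<in> {1..n}. (j, i) \<in> r} else i) (?R x))
      \<in> measurable (array_measure n) (count_space UNIV)"
    by (rule measurable_compose) simp
  then show ?thesis
    by (subst inverse_unfair_perm_eq_on[abs_def]) simp
qed

lemma measurable_unfair_perm:
  "unfair_perm n \<in> measurable (array_measure n) (count_space UNIV)"
  unfolding unfair_perm_def[abs_def]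
  by (rule measurable_compose[OF measurable_inverse_unfair_perm]) simp

lemma distr_uniform_array:
  assumes "uniform_array n M X" and "n \<ge> 1"
  shows "distr M (array_measure n) (\<lambda>\<omega>. \<lambda>(i, j)\<in>array_index n. X i j \<omega>) = array_measure n"
    and "(\<lambda>\<omega>. \<lambda>(i, j)\<in>array_index n. X i j \<omega>) \<in> measurable M (array_measure n)"
proof -
  interpret prob_space M using assms by (simp add: uniform_array_def)
  let ?Y = "\<lambda>(i, j). X i j"
  have ind: "indep_vars (\<lambda>_. borel) ?Y (array_index n)"
    using assms by (simp add: uniform_array_def)
  have rv: "?Y p \<in> measurable M borel" if "p \<in> array_index n" for p
    using ind that unfolding indep_vars_def by blast
  have d: "distr M borel (?Y p) = unit_uniform" if "p \<in> array_index n" for p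
    using assms that by (auto simp: uniform_array_def array_index_def)
  have "(1, 1) \<in> array_index n" using \<open>n \<ge> 1\<close> by (simp add: array_index_def)
  then have ne: "array_index n \<noteq> {}" by blast
  have s: "sets (array_measure n) = sets (\<Pi>\<^sub>M p\<in>array_index n. (borel :: real measure))"
    unfolding array_measure_def by (rule sets_PiM_cong) auto
  have e: "(\<lambda>\<omega>. \<lambda>(i, j)\<in>array_index n. X i j \<omega>) = (\<lambda>\<omega>. \<lambda>p\<in>array_index n. ?Y p \<omega>)"
    by (auto simp: fun_eq_iff restrict_def)
  have m: "(\<lambda>\<omega>. \<lambda>p\<in>array_index n. ?Y p \<omega>) \<in> measurable M (\<Pi>\<^sub>M p\<in>array_index n. borel)"
    by (intro measurable_restrict rv)
  show "(\<lambda>\<omega>. \<lambda>(i, j)\<in>array_index n. X i j \<omega>) \<in> measurable M (array_measure n)"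
    unfolding e using m measurable_cong_sets[OF refl s] by blast
  have "distr M (array_measure n) (\<lambda>\<omega>. \<lambda>p\<in>array_index n. ?Y p \<omega>) =
      distr M (\<Pi>\<^sub>M p\<in>array_index n. borel) (\<lambda>\<omega>. \<lambda>p\<in>array_index n. ?Y p \<omega>)"
    by (rule distr_cong) (auto simp: s)
  also have "\<dots> = (\<Pi>\<^sub>M p\<in>array_index n. distr M borel (?Y p))"
    using iffD1[OF indep_vars_iff_distr_eq_PiM'[OF ne rv] ind] .
  also have "\<dots> = array_measure n"
    unfolding array_measure_def by (rule PiM_cong) (auto simp: d)
  finally show "distr M (array_measure n) (\<lambda>\<omega>. \<lambda>(i, j)\<in>array_index n. X i j \<omega>) = array_measure n"
    unfolding e .
qed

lemma inverse_unfair_perm_restrict: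
  "inverse_unfair_perm n (restrict x (array_index n)) = inverse_unfair_perm n x"
proof -
  have "score (restrict x (array_index n)) i = score x i" if "i \<in> {1..n}" for i
    using that unfolding score_def by (auto intro!: arg_cong[where f=Max] simp: array_index_def)
  then show ?thesis
    unfolding inverse_unfair_perm_def rank_among_def by (intro ext) (auto intro!: arg_cong[where f=card])
qed

lemma law_inverse_unfair_perm:
  assumes "uniform_array n M X" and "n \<ge> 1"
  shows "law M (\<lambda>\<omega>. inverse_unfair_perm n (\<lambda>(i, j). X i j \<omega>)) = inverse_unfair_law n"
  unfolding inverse_unfair_law_def law_def
  by (subst distr_uniform_array(1)[OF assms, symmetric],
      subst distr_distr[OF measurable_inverse_unfair_perm distr_uniform_array(2)[OF assms]])
     (simp add: comp_def inverse_unfair_perm_restrict)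

lemma law_unfair_perm:
  assumes "uniform_array n M X" and "n \<ge> 1"
  shows "law M (\<lambda>\<omega>. unfair_perm n (\<lambda>(i, j). X i j \<omega>)) = unfair_law n"
  unfolding unfair_law_def law_def
  by (subst distr_uniform_array(1)[OF assms, symmetric],
      subst distr_distr[OF measurable_unfair_perm distr_uniform_array(2)[OF assms]])
     (simp add: comp_def unfair_perm_def inverse_unfair_perm_restrict)

end

theory Submission
  imports Defs "HOL-Real_Asymp.Real_Asymp"
begin

text \<open>The laws are separated by the number \<open>T\<close> of indices \<open>k \<le> m = n div 2\<close> whose value exceeds the value at
  \<open>k + m\<close>. Under the uniform law the \<open>m\<close> indicators are fair and uncorrelated, as composing with
  the transposition of \<open>k\<close> and \<open>k + m\<close> flips only the \<open>k\<close>-th one; by Chebyshev \<open>T \<ge> 5m/12\<close> with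
  probability at least \<open>1 - 36/m\<close>. Under the inverse-unfair law the indicators depend on disjoint
  rows of the array, hence are independent, and each has mean at most \<open>1/3\<close>: row \<open>k + m\<close> contains
  two disjoint blocks of the size of row \<open>k\<close>. By Hoeffding \<open>T \<ge> 5m/12\<close> has probability at most
  \<open>exp (- m/72)\<close>. Inverting all permutations transfers this to the unfair law.\<close>

section \<open>Exchangeability of i.i.d. coordinates\<close>

text \<open>Since \<open>A\<close> and \<open>B\<close> are disjoint, a bijection \<open>g\<close>
  on \<open>A\<close> glued to its inverse on \<open>B\<close> is an involution. It serves to
  exchange two blocks of coordinates.\<close>

lemma ex_permutes_swap_sets:
  assumes "finite A" "finite B" "card A = card B" "A \<inter> B = {}" "A \<subseteq> I" "B \<subseteq> I"
  obtains \<sigma> where "\<sigma> permutes I" "\<sigma> ` A = B" "\<sigma> ` B = A" "\<And>x. x \<notin> A \<union> B \<Longrightarrow> \<sigma> x = x"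
proof -
  obtain g where g: "bij_betw g A B"
    using finite_same_card_bij[OF assms(1-3)] by blast
  let ?h = "inv_into A g"
  have h: "bij_betw ?h B A"
    using g by (rule bij_betw_inv_into)
  define \<sigma> where "\<sigma> x = (if x \<in> A then g x else if x \<in> B then ?h x else x)" for x
  have gB: "g x \<in> B" if "x \<in> A" for x using g that by (auto simp: bij_betw_def)
  have hA: "?h x \<in> A" if "x \<in> B" for x using h that by (auto simp: bij_betw_def)
  have nA: "x \<notin> A" if "x \<in> B" for x using assms that by auto
  have "\<sigma> (\<sigma> x) = x" for x
    using gB[of x] hA[of x] nA[of x] nA[of "g x"] bij_betw_inv_into_left[OF g, of x]
      bij_betw_inv_into_right[OF g, of x] by (auto simp: \<sigma>_def)
  then have "bij \<sigma>" by (rule involuntory_imp_bij)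
  then have "\<sigma> permutes I"
    using assms unfolding permutes_def bij_iff by (auto simp: \<sigma>_def)
  moreover have "\<sigma> ` A = B" using g by (simp add: \<sigma>_def bij_betw_def)
  moreover have "\<sigma> ` B = A"
  proof -
    have "\<sigma> ` B = ?h ` B" using nA by (intro image_cong) (auto simp: \<sigma>_def)
    then show ?thesis using h by (simp add: bij_betw_def)
  qed
  moreover have "\<And>x. x \<notin> A \<union> B \<Longrightarrow> \<sigma> x = x" by (simp add: \<sigma>_def)
  ultimately show ?thesis using that by blast
qed

text \<open>All factors are the same \<open>N\<close>, so reindexing the coordinates by
  \<open>\<sigma>\<close> preserves the product measure; the left-hand event is the preimage of the
  right-hand one under this map.\<close>

lemma measure_PiM_permutes:
  assumes "prob_space N" and \<sigma>: "\<sigma> permutes I"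
    and P: "{x \<in> space (PiM I (\<lambda>_. N)). P x} \<in> sets (PiM I (\<lambda>_. N))"
  shows "measure (PiM I (\<lambda>_. N)) {x \<in> space (PiM I (\<lambda>_. N)). P (restrict (x \<circ> \<sigma>) I)} =
    measure (PiM I (\<lambda>_. N)) {x \<in> space (PiM I (\<lambda>_. N)). P x}"
proof -
  let ?M = "PiM I (\<lambda>_. N)" and ?f = "\<lambda>x. \<lambda>i\<in>I. x (\<sigma> i)"
  have in_I: "\<sigma> i \<in> I" if "i \<in> I" for i using that permutes_in_image[OF \<sigma>] by simp
  have f: "?f \<in> measurable ?M ?M"
    using in_I by (intro measurable_restrict measurable_component_singleton)
  have "distr ?M ?M ?f = ?M"
    using assms in_I by (intro distr_PiM_reindex) (auto intro: permutes_inj_on)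
  then have "measure ?M {x \<in> space ?M. P x} = measure (distr ?M ?M ?f) {x \<in> space ?M. P x}"
    by simp
  also have "\<dots> = measure ?M (?f -` {x \<in> space ?M. P x} \<inter> space ?M)"
    using f P by (rule measure_distr)
  also have "?f -` {x \<in> space ?M. P x} \<inter> space ?M = {x \<in> space ?M. P (restrict (x \<circ> \<sigma>) I)}"
    using measurable_space[OF f] by (auto simp: comp_def)
  finally show ?thesis by simp
qed

lemma borel_measurable_PiM_Max:
  fixes N :: "real measure"
  assumes "sets N = sets borel" "finite U" "U \<subseteq> I"
  shows "(\<lambda>x. Max (x ` U)) \<in> borel_measurable (PiM I (\<lambda>_. N))"
proof (rule borel_measurable_Max)
  fix i assume "i \<in> U"
  then have "(\<lambda>x. x i) \<in> measurable (PiM I (\<lambda>_. N)) N"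
    using assms by (intro measurable_component_singleton) auto
  then show "(\<lambda>x. x i) \<in> borel_measurable (PiM I (\<lambda>_. N))"
    using measurable_cong_sets[OF refl assms(1)] by blast
qed fact

text \<open>Permuting coordinates makes all blocks equally likely to contain the strict overall
  maximum, and these events are disjoint.\<close>

lemma prob_strict_max_block_le:
  fixes N :: "real measure" and U :: "'t \<Rightarrow> 'i set"
  assumes N: "prob_space N" "sets N = sets borel"
    and T: "finite T" "c \<in> T"
    and fin: "\<And>a. a \<in> T \<Longrightarrow> finite (U a)" and sub: "\<And>a. a \<in> T \<Longrightarrow> U a \<subseteq> I"
    and card: "\<And>a b. a \<in> T \<Longrightarrow> b \<in> T \<Longrightarrow> card (U a) = card (U b)"
    and disj: "disjoint_family_on U T"
  shows "measure (PiM I (\<lambda>_. N))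
    {x \<in> space (PiM I (\<lambda>_. N)). \<forall>b\<in>T - {c}. Max (x ` U b) < Max (x ` U c)} \<le> 1 / card T"
proof -
  let ?M = "PiM I (\<lambda>_. N)"
  interpret prob_space ?M using N by (intro prob_space_PiM) auto
  define E where "E a x \<longleftrightarrow> (\<forall>b\<in>T - {a}. Max (x ` U b) < Max (x ` U a))" for a and x :: "'i \<Rightarrow> real"
  have meas: "{x \<in> space ?M. E a x} \<in> sets ?M" if "a \<in> T" for a
    unfolding E_def using that T N fin sub
    by (intro sets.sets_Collect_finite_All borel_measurable_less borel_measurable_PiM_Max) auto
  have eq: "prob {x \<in> space ?M. E a x} = prob {x \<in> space ?M. E c x}" if a: "a \<in> T" for a
  proof (cases "a = c")
    case False
    have "U a \<inter> U c = {}" using disj a T(2) False by (auto simp: disjoint_family_on_def)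
    then obtain \<sigma> where \<sigma>: "\<sigma> permutes I" "\<sigma> ` U a = U c" "\<sigma> ` U c = U a"
      and fix': "\<And>x. x \<notin> U a \<union> U c \<Longrightarrow> \<sigma> x = x"
      using ex_permutes_swap_sets[of "U a" "U c" I] fin sub card a T(2) by metis
    \<comment> \<open>On block indices \<open>\<sigma>\<close> acts as the transposition of
      \<open>a\<close> and \<open>c\<close>: every other block is disjoint from both and stays fixed
      pointwise.\<close>
    have img: "\<sigma> ` U b = U (Transposition.transpose a c b)" if "b \<in> T" for b
    proof (cases "b = a \<or> b = c")
      case True then show ?thesis using \<sigma> by auto
    next
      case b: False
      have "U b \<inter> (U a \<union> U c) = {}"
        using disj a T(2) that b by (auto simp: disjoint_family_on_def)
      then have "\<sigma> ` U b = id ` U b" by (intro image_cong) (auto intro: fix')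
      then show ?thesis using b by (simp add: Transposition.transpose_apply_other)
    qed
    have Max_img: "Max (restrict (x \<circ> \<sigma>) I ` U b) = Max (x ` U (Transposition.transpose a c b))" if "b \<in> T" for x b
    proof -
      have "restrict (x \<circ> \<sigma>) I ` U b = x ` \<sigma> ` U b"
        using sub[OF that] by (auto simp: image_image intro!: image_cong)
      then show ?thesis using img[OF that] by simp
    qed
    \<comment> \<open>Permuting the coordinates thus turns the event that block \<open>c\<close>
      wins into the event that block \<open>a\<close> wins.\<close>
    have "E c y = E a x" if y: "\<And>b. b \<in> T \<Longrightarrow> Max (y ` U b) = Max (x ` U (Transposition.transpose a c b))"
      for x y
    proof -
      have "E c y \<longleftrightarrow> (\<forall>b\<in>T - {c}. Max (x ` U (Transposition.transpose a c b)) < Max (x ` U a))"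
        unfolding E_def using T(2) by (simp add: y)
      also have "\<dots> \<longleftrightarrow> (\<forall>b\<in>Transposition.transpose a c ` (T - {c}). Max (x ` U b) < Max (x ` U a))"
        by simp
      also have "Transposition.transpose a c ` (T - {c}) = T - {a}"
        using a T(2) by (auto simp: Transposition.transpose_def image_iff)
      finally show ?thesis by (simp add: E_def)
    qed
    then have "E c (restrict (x \<circ> \<sigma>) I) = E a x" for x
      using Max_img by blast
    then show ?thesis
      using measure_PiM_permutes[OF N(1) \<sigma>(1) meas[OF T(2)]] by simp
  qed simp
  have "card T * prob {x \<in> space ?M. E c x} = (\<Sum>a\<in>T. prob {x \<in> space ?M. E a x})"
    using eq by simp
  also have "\<dots> = prob (\<Union>a\<in>T. {x \<in> space ?M. E a x})"
  proof (rule finite_measure_finite_Union[symmetric])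
    show "disjoint_family_on (\<lambda>a. {x \<in> space ?M. E a x}) T"
    proof -
      have "\<not> (E a x \<and> E b x)" if "a \<in> T" "b \<in> T" "a \<noteq> b" for a b x
        using that unfolding E_def by (metis DiffI less_asym singletonD)
      then show ?thesis by (auto simp: disjoint_family_on_def)
    qed
  qed (use T meas in auto)
  also have "\<dots> \<le> 1" by simp
  finally have "card T * prob {x \<in> space ?M. E c x} \<le> 1" .
  moreover have "card T > 0" using T card_gt_0_iff by blast
  ultimately show ?thesis by (simp add: E_def field_simps)
qed

section \<open>Absence of ties, scores and ranks\<close>

text \<open>Fubini, integrating over coordinate \<open>p\<close> first: with the others fixed, a tie
  with coordinate \<open>q\<close> means hitting the single point \<open>x q\<close>, which has mass
  zero. Finitely many pairs are then combined.\<close>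

lemma AE_PiM_components_distinct:
  fixes N :: "real measure"
  assumes "prob_space N" "sets N = sets borel" and null: "\<And>a. emeasure N {a} = 0"
    and I: "finite I"
  shows "AE x in PiM I (\<lambda>_. N). inj_on x I"
proof -
  interpret product_prob_space "\<lambda>_. N" I by (intro product_prob_spaceI assms)
  have neq: "AE x in PiM I (\<lambda>_. N). x p \<noteq> x q" if pq: "p \<in> I" "q \<in> I" "p \<noteq> q" for p q
  proof -
    let ?M = "PiM I (\<lambda>_. N)" and ?J = "I - {p}"
    have I_eq: "insert p ?J = I" using pq by auto
    have comp: "(\<lambda>x. x i) \<in> borel_measurable ?M" if "i \<in> I" for i
      using measurable_component_singleton[OF that, of "\<lambda>_. N"]
        measurable_cong_sets[OF refl assms(2)] by blast
    have S: "{x \<in> space ?M. x p = x q} \<in> sets ?M"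
      using comp pq by (intro borel_measurable_eq) auto
    let ?f = "indicator {x \<in> space ?M. x p = x q} :: _ \<Rightarrow> ennreal"
    have "emeasure ?M {x \<in> space ?M. x p = x q} = (\<integral>\<^sup>+x. ?f x \<partial>PiM (insert p ?J) (\<lambda>_. N))"
      unfolding I_eq using S by simp
    also have "\<dots> = (\<integral>\<^sup>+x. (\<integral>\<^sup>+y. ?f (x(p := y)) \<partial>N) \<partial>PiM ?J (\<lambda>_. N))"
    proof (rule product_nn_integral_insert)
      show "?f \<in> borel_measurable (PiM (insert p ?J) (\<lambda>_. N))"
        unfolding I_eq using S by (rule borel_measurable_indicator)
    qed (use I in auto)
    also have "\<dots> \<le> (\<integral>\<^sup>+x. (\<integral>\<^sup>+y. indicator {x q} y \<partial>N) \<partial>PiM ?J (\<lambda>_. N))"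
      using pq by (intro nn_integral_mono) (auto simp: indicator_def)
    also have "\<dots> = 0" using null assms(2) by simp
    finally show ?thesis
      using S by (intro AE_I[of _ _ "{x \<in> space ?M. x p = x q}"]) auto
  qed
  have "AE x in PiM I (\<lambda>_. N). \<forall>p\<in>I. \<forall>q\<in>I. p \<noteq> q \<longrightarrow> x p \<noteq> x q"
    using I neq by (auto intro!: AE_finite_allI)
  then show ?thesis by eventually_elim (auto simp: inj_on_def)
qed

lemma emeasure_unit_uniform_singleton: "emeasure unit_uniform {a} = 0"
proof -
  have "emeasure lborel ({0<..<1} \<inter> {a}) \<le> emeasure lborel {a}"
    by (intro emeasure_mono) auto
  then show ?thesis
    by (simp add: unit_uniform_def emeasure_uniform_measure)
qed

lemma score_eq_Max_row: "score x i = Max (x ` ({i} \<times> {1..i}))"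
proof -
  have "(\<lambda>j. x (i, j)) ` {1..i} = x ` ({i} \<times> {1..i})" by auto
  then show ?thesis by (simp add: score_def)
qed

text \<open>Sublevel sets are nested, and for \<open>z i < z j\<close> the inclusion is strict
  because only the larger one contains \<open>j\<close>. Tied values share a rank, so ranks can be
  compared through scores at every point of the array space.\<close>

lemma rank_among_less_iff:
  assumes "i \<in> {1..n}" "j \<in> {1..n}"
  shows "rank_among n z i < rank_among n z j \<longleftrightarrow> z i < z j"
proof (cases "z i < z j")
  case True
  then have "j \<notin> {k \<in> {1..n}. z k \<le> z i}" "j \<in> {k \<in> {1..n}. z k \<le> z j}"
    "{k \<in> {1..n}. z k \<le> z i} \<subseteq> {k \<in> {1..n}. z k \<le> z j}"
    using assms by auto
  then have "{k \<in> {1..n}. z k \<le> z i} \<subset> {k \<in> {1..n}. z k \<le> z j}"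
    by blast
  then have "rank_among n z i < rank_among n z j"
    unfolding rank_among_def by (intro psubset_card_mono) auto
  then show ?thesis using True by simp
next
  case False
  then have "rank_among n z j \<le> rank_among n z i"
    unfolding rank_among_def by (intro card_mono) auto
  then show ?thesis using False by simp
qed

text \<open>Each score is an entry of its own row, so tied scores would be equal entries at distinct
  positions, which almost surely do not exist. The ranks then form an injection of
  \<open>{1..n}\<close> into itself.\<close>

lemma AE_inverse_unfair_perm_in_sym_group:
  "AE x in array_measure n. inverse_unfair_perm n x \<in> sym_group n"
proof -
  have "AE x in array_measure n. inj_on x (array_index n)"
    unfolding array_measure_def
    by (intro AE_PiM_components_distinct prob_space_unit_uniform finite_array_index
        emeasure_unit_uniform_singleton sets_unit_uniform)
  then show ?thesis
  proof eventually_elim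
    fix x :: "nat \<times> nat \<Rightarrow> real" assume inj: "inj_on x (array_index n)"
    have score_attained: "\<exists>j\<in>{1..i}. score x i = x (i, j)" if "i \<in> {1..n}" for i
    proof -
      have "Max ((\<lambda>j. x (i, j)) ` {1..i}) \<in> (\<lambda>j. x (i, j)) ` {1..i}"
        using that by (intro Max_in) auto
      then show ?thesis by (auto simp: score_def)
    qed
    have "i = j" if ij: "i \<in> {1..n}" "j \<in> {1..n}" and eq: "score x i = score x j" for i j
    proof -
      obtain a b where ab: "a \<in> {1..i}" "b \<in> {1..j}" "x (i, a) = x (j, b)"
        using score_attained[OF ij(1)] score_attained[OF ij(2)] eq by metis
      have "(i, a) = (j, b)"
        by (rule inj_onD[OF inj ab(3)]) (use ab ij in \<open>auto simp: array_index_def\<close>)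
      then show ?thesis by simp
    qed
    then have "inj_on (rank_among n (score x)) {1..n}"
      using rank_among_less_iff[of _ n _ "score x"]
      by (intro inj_onI) (metis less_irrefl linorder_neqE)
    moreover have "rank_among n (score x) i \<in> {1..n}" if "i \<in> {1..n}" for i
    proof -
      have "card {i} \<le> rank_among n (score x) i"
        unfolding rank_among_def using that by (intro card_mono) auto
      moreover have "rank_among n (score x) i \<le> card {1..n}"
        unfolding rank_among_def by (intro card_mono) auto
      ultimately show ?thesis by simp
    qed
    moreover have eq: "inverse_unfair_perm n x i = rank_among n (score x) i" if "i \<in> {1..n}" for i
      unfolding inverse_unfair_perm_def using that by (rule if_P)
    moreover have "inj_on (inverse_unfair_perm n x) {1..n} = inj_on (rank_among n (score x)) {1..n}"
      by (rule inj_on_cong) (rule eq)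
    ultimately have "inj_on (inverse_unfair_perm n x) {1..n}"
      "\<And>i. i \<in> {1..n} \<Longrightarrow> inverse_unfair_perm n x i \<in> {1..n}"
      by metis+
    moreover have "inverse_unfair_perm n x i = i" if "i \<notin> {1..n}" for i
      unfolding inverse_unfair_perm_def using that by (rule if_not_P)
    ultimately show "inverse_unfair_perm n x \<in> sym_group n"
      unfolding sym_group_def by (blast intro: inj_imp_permutes)
  qed
qed

section \<open>The separating statistic under the uniform law\<close>

text \<open>The statistic \<open>T\<close>. The pairs of \<open>k\<close> and
  \<open>k + n div 2\<close> are disjoint, and the larger index is at least twice the smaller one.
  For odd \<open>n\<close> the index \<open>n\<close> lies in no pair.\<close>

definition half_descents :: "nat \<Rightarrow> (nat \<Rightarrow> nat) \<Rightarrow> nat" where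
  "half_descents n f = card {k \<in> {1..n div 2}. f (k + n div 2) < f k}"

lemma half_descents_eq_sum:
  "real (half_descents n f) = (\<Sum>k\<in>{1..n div 2}. of_bool (f (k + n div 2) < f k))"
proof -
  have "(\<Sum>k\<in>{1..n div 2}. of_bool (f (k + n div 2) < f k)) =
      (\<Sum>k | k \<in> {1..n div 2} \<and> f (k + n div 2) < f k. 1 :: real)"
    by (rule sum.mono_neutral_cong_right) auto
  then show ?thesis by (simp add: half_descents_def)
qed

lemma finite_sym_group: "finite (sym_group n)"
  unfolding sym_group_def by (rule finite_permutations) simp

lemma id_in_sym_group: "id \<in> sym_group n"
  unfolding sym_group_def by (simp add: permutes_id)

text \<open>Chebyshev's inequality, carried out by counting: the second moment of
  \<open>2 * T - m\<close> is summed over the whole symmetric group.\<close>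

lemma prob_uniform_half_descents_ge:
  assumes "n \<ge> 2"
  shows "measure (uniform_law n) {p \<in> sym_group n. 5 * (n div 2) \<le> 12 * half_descents n p}
    \<ge> 1 - 36 / real (n div 2)"
proof -
  define m where "m = n div 2"
  define S where "S = sym_group n"
  \<comment> \<open>Signs instead of 0/1 indicators are centred, so being uncorrelated becomes plain
    orthogonality.\<close>
  define s where "s k p = (if p (k + m) < p k then 1 else - 1 :: real)" for k and p :: "nat \<Rightarrow> nat"
  have m: "m \<ge> 1" "m + m \<le> n" using assms by (auto simp: m_def)
  have fin: "finite S" and S_ne: "S \<noteq> {}"
    using finite_sym_group id_in_sym_group by (auto simp: S_def)
  \<comment> \<open>Composing with the transposition of \<open>k\<close> and \<open>k + m\<close> is
    an involution of \<open>S\<close> that flips \<open>s k\<close> and keeps \<open>s l\<close>, so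
    the sum equals its own negative.\<close>
  have orth: "(\<Sum>p\<in>S. s k p * s l p) = 0" if kl: "k \<in> {1..m}" "l \<in> {1..m}" "k \<noteq> l" for k l
  proof -
    let ?\<tau> = "Transposition.transpose k (k + m)"
    have \<tau>: "?\<tau> permutes {1..n}" using kl m by (intro permutes_swap_id) auto
    have invol: "p \<circ> ?\<tau> \<circ> ?\<tau> = p" for p :: "nat \<Rightarrow> nat"
      by (simp add: comp_assoc)
    have mem: "p \<circ> ?\<tau> \<in> S" if "p \<in> S" for p
      using that \<tau> permutes_compose unfolding S_def sym_group_def by blast
    have flip: "- (s k (p \<circ> ?\<tau>) * s l (p \<circ> ?\<tau>)) = s k p * s l p" if "p \<in> S" for p
    proof -
      have "inj p" using that unfolding S_def sym_group_def by (blast intro: permutes_inj)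
      then have "p (k + m) \<noteq> p k" using m by (simp add: inj_eq)
      then have "s k (p \<circ> ?\<tau>) = - s k p" by (simp add: s_def)
      moreover have "s l (p \<circ> ?\<tau>) = s l p"
      proof -
        have "l \<noteq> k" "l \<noteq> k + m" "l + m \<noteq> k" "l + m \<noteq> k + m" using kl by auto
        then show ?thesis by (simp add: s_def Transposition.transpose_apply_other)
      qed
      ultimately show ?thesis by simp
    qed
    have "(\<Sum>p\<in>S. s k p * s l p) = (\<Sum>p\<in>S. - (s k p * s l p))"
      by (rule sum.reindex_bij_witness[of S "\<lambda>p. p \<circ> ?\<tau>" "\<lambda>p. p \<circ> ?\<tau>"])
         (rule invol mem flip, assumption?)+
    then show ?thesis by (simp add: sum_negf)
  qed
  have "(\<Sum>p\<in>S. (\<Sum>k\<in>{1..m}. s k p)\<^sup>2) = (\<Sum>p\<in>S. \<Sum>k\<in>{1..m}. \<Sum>l\<in>{1..m}. s k p * s l p)"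
    by (simp add: power2_eq_square sum_product)
  also have "\<dots> = (\<Sum>k\<in>{1..m}. \<Sum>l\<in>{1..m}. \<Sum>p\<in>S. s k p * s l p)"
    by (subst sum.swap) (intro sum.cong refl sum.swap)
  also have "\<dots> = (\<Sum>k\<in>{1..m}. \<Sum>l\<in>{1..m}. if k = l then real (card S) else 0)"
  proof (intro sum.cong refl)
    fix k l assume kl: "k \<in> {1..m}" "l \<in> {1..m}"
    have "s k p * s k p = 1" for p by (simp add: s_def)
    then show "(\<Sum>p\<in>S. s k p * s l p) = (if k = l then real (card S) else 0)"
      using orth[OF kl] by auto
  qed
  also have "\<dots> = real m * real (card S)" by simp
  finally have second_moment: "(\<Sum>p\<in>S. (\<Sum>k\<in>{1..m}. s k p)\<^sup>2) = real m * real (card S)" .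
  have sum_s: "(\<Sum>k\<in>{1..m}. s k p) = 2 * real (half_descents n p) - real m" for p
  proof -
    have "(\<Sum>k\<in>{1..m}. s k p) = (\<Sum>k\<in>{1..m}. 2 * of_bool (p (k + m) < p k) - 1)"
      by (intro sum.cong) (auto simp: s_def)
    then show ?thesis
      by (simp add: half_descents_eq_sum sum_subtractf sum_distrib_left m_def)
  qed
  let ?G = "{p \<in> S. 5 * m \<le> 12 * half_descents n p}"
  \<comment> \<open>Outside \<open>?G\<close>, \<open>T < 5m/12\<close> gives
    \<open>2T - m < - m/6\<close>, so each such permutation contributes at least
    \<open>(m/6)^2\<close> to the second moment.\<close>
  have "real (card (S - ?G)) * (real m / 6)\<^sup>2 = (\<Sum>p\<in>S - ?G. (real m / 6)\<^sup>2)" by simp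
  also have "\<dots> \<le> (\<Sum>p\<in>S - ?G. (\<Sum>k\<in>{1..m}. s k p)\<^sup>2)"
  proof (rule sum_mono)
    fix p assume "p \<in> S - ?G"
    then have "12 * half_descents n p < 5 * m" by auto
    then have "12 * real (half_descents n p) < 5 * real m" by linarith
    then have "real m / 6 \<le> \<bar>\<Sum>k\<in>{1..m}. s k p\<bar>" unfolding sum_s by linarith
    then show "(real m / 6)\<^sup>2 \<le> (\<Sum>k\<in>{1..m}. s k p)\<^sup>2"
      by (metis abs_of_nonneg abs_le_square_iff of_nat_0_le_iff zero_le_divide_iff zero_le_numeral)
  qed
  also have "\<dots> \<le> (\<Sum>p\<in>S. (\<Sum>k\<in>{1..m}. s k p)\<^sup>2)"
    using fin by (intro sum_mono2) auto
  also note second_moment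
  finally have "real m * (real m * real (card (S - ?G))) \<le> real m * (36 * real (card S))"
    by (simp add: power2_eq_square field_simps)
  then have "real m * real (card (S - ?G)) \<le> 36 * real (card S)"
    using m by (subst (asm) mult_le_cancel_left_pos) auto
  also have "real (card (S - ?G)) = real (card S) - real (card ?G)"
    using fin by (subst card_Diff_subset) (auto simp: card_mono of_nat_diff)
  finally have "real m * real (card S) - 36 * real (card S) \<le> real m * real (card ?G)"
    by (simp add: right_diff_distrib)
  moreover have "card S > 0" using fin S_ne card_gt_0_iff by blast
  ultimately have "1 - 36 / real m \<le> real (card ?G) / real (card S)"
    using m by (simp add: field_simps)
  also have "\<dots> = measure (uniform_law n) ?G"
    unfolding uniform_law_def S_def[symmetric] using fin S_ne
    by (subst measure_pmf_of_set) (auto intro!: arg_cong[where f = card])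
  finally show ?thesis by (simp add: m_def S_def)
qed

section \<open>The separating statistic under the inverse-unfair law\<close>

lemma prob_space_array_measure: "prob_space (array_measure n)"
  unfolding array_measure_def by (intro prob_space_PiM prob_space_unit_uniform)

text \<open>If row \<open>k\<close> beats row \<open>l\<close>, its maximum strictly exceeds those
  of two blocks of \<open>k\<close> entries inside row \<open>l\<close>. Being the winner among
  three exchangeable blocks has probability at most \<open>1/3\<close>.\<close>

lemma prob_score_less_le:
  assumes "1 \<le> k" "2 * k \<le> l" "l \<le> n"
  shows "measure (array_measure n) {x \<in> space (array_measure n). score x l < score x k} \<le> 1 / 3"
proof -
  \<comment> \<open>Block 0 is row \<open>k\<close>; blocks 1 and 2 are the first two runs of
    \<open>k\<close> entries in row \<open>l\<close>, which fit because
    \<open>2 * k \<le> l\<close>.\<close>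
  define U :: "nat \<Rightarrow> (nat \<times> nat) set" where
    "U a = (if a = 0 then {k} \<times> {1..k} else {l} \<times> {(a - 1) * k + 1..a * k})" for a
  let ?M = "array_measure n"
  let ?E = "{x \<in> space ?M. \<forall>b\<in>{0, 1, 2} - {0}. Max (x ` U b) < Max (x ` U 0)}"
  interpret prob_space ?M by (rule prob_space_array_measure)
  have fin: "finite (U a)" for a by (simp add: U_def)
  have sub: "U a \<subseteq> array_index n" if "a \<in> {0, 1, 2}" for a
    using assms that by (auto simp: U_def array_index_def)
  have card_U: "card (U a) = k" if "a \<in> {0, 1, 2}" for a
    using that by (auto simp: U_def card_cartesian_product)
  have disj: "disjoint_family_on U {0, 1, 2}"
    using assms by (auto simp: disjoint_family_on_def U_def)
  have Max_row: "Max (x ` U b) \<le> score x l" if "b \<in> {0, 1, 2} - {0}" for b and x :: "nat \<times> nat \<Rightarrow> real"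
  proof -
    have "U b \<subseteq> {l} \<times> {1..l}" "U b \<noteq> {}" using assms that by (auto simp: U_def)
    then show ?thesis
      unfolding score_eq_Max_row by (intro Max_mono) (auto intro: image_mono)
  qed
  have "Max (x ` U 0) = score x k" for x :: "nat \<times> nat \<Rightarrow> real"
    by (simp add: score_eq_Max_row U_def)
  then have "{x \<in> space ?M. score x l < score x k} \<subseteq> ?E"
    using order.strict_trans1[OF Max_row] by (intro Collect_mono conj_mono) simp_all
  moreover have "?E \<in> sets ?M"
    unfolding array_measure_def using sub
    by (intro sets.sets_Collect_finite_All borel_measurable_less borel_measurable_PiM_Max
          sets_unit_uniform fin) auto
  ultimately have "prob {x \<in> space ?M. score x l < score x k} \<le> prob ?E"
    by (rule finite_measure_mono)
  also have "\<dots> \<le> 1 / card {0, 1, 2 :: nat}"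
    unfolding array_measure_def
    by (rule prob_strict_max_block_le[OF prob_space_unit_uniform sets_unit_uniform _ _ fin sub _ disj])
       (simp_all add: card_U)
  finally show ?thesis by simp
qed

text \<open>Independence is equivalent to the joint law being the product of the marginals. Here the
  joint map is the identity on the product space, and the marginals are the factors.\<close>

lemma indep_vars_PiM_coordinates:
  assumes N: "\<And>i. i \<in> I \<Longrightarrow> prob_space (N i)" and "I \<noteq> {}"
  shows "prob_space.indep_vars (PiM I N) N (\<lambda>i x. x i) I"
proof -
  interpret prob_space "PiM I N" using N by (rule prob_space_PiM)
  have "distr (PiM I N) (PiM I N) (\<lambda>x. \<lambda>i\<in>I. x i) = distr (PiM I N) (PiM I N) (\<lambda>x. x)"
    by (intro distr_cong) (auto simp: space_PiM)
  also have "\<dots> = (\<Pi>\<^sub>M i\<in>I. distr (PiM I N) (N i) (\<lambda>x. x i))"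
    using N by (simp add: distr_PiM_component cong: PiM_cong)
  finally show ?thesis
    using \<open>I \<noteq> {}\<close> by (subst indep_vars_iff_distr_eq_PiM') auto
qed

lemma prob_inverse_unfair_half_descents_ge:
  assumes "n \<ge> 2"
  shows "measure (array_measure n) {x \<in> space (array_measure n).
      5 * (n div 2) \<le> 12 * half_descents n (inverse_unfair_perm n x)} \<le> exp (- real (n div 2) / 72)"
proof -
  define m where "m = n div 2"
  have m: "m \<ge> 1" "m + m \<le> n" using assms by (auto simp: m_def)
  let ?M = "array_measure n"
  interpret prob_space ?M by (rule prob_space_array_measure)
  define X where "X k x = (of_bool (score x (k + m) < score x k) :: real)" for k x
  \<comment> \<open>\<open>K k\<close> consists of rows \<open>k\<close> and \<open>k + m\<close>,
    all that \<open>X k\<close> looks at; these sets are disjoint for distinct \<open>k\<close> in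
    \<open>{1..m}\<close>. Functions of disjoint groups of independent coordinates are
    independent.\<close>
  define K where "K k = {k} \<times> {1..k} \<union> {k + m} \<times> {1..k + m}" for k
  have "indep_vars (\<lambda>_. unit_uniform) (\<lambda>p x. x p) (array_index n)"
    unfolding array_measure_def
  proof (intro indep_vars_PiM_coordinates prob_space_unit_uniform)
    have "(1, 1) \<in> array_index n" using m by (simp add: array_index_def)
    then show "array_index n \<noteq> {}" by blast
  qed
  then have "indep_vars (\<lambda>k. PiM (K k) (\<lambda>_. unit_uniform)) (\<lambda>k x. restrict (\<lambda>p. x p) (K k)) {1..m}"
    by (rule indep_vars_restrict) (use m in \<open>auto simp: K_def array_index_def disjoint_family_on_def\<close>)
  then have "indep_vars (\<lambda>_. borel) (\<lambda>k x. X k (restrict x (K k))) {1..m}"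
  proof (rule indep_vars_compose2)
    fix k
    have "(\<lambda>x. score x i) \<in> borel_measurable (PiM (K k) (\<lambda>_. unit_uniform))" if "i \<in> {k, k + m}" for i
      unfolding score_eq_Max_row using that
      by (intro borel_measurable_PiM_Max sets_unit_uniform) (auto simp: K_def)
    then have [measurable]: "(\<lambda>x. score x k) \<in> borel_measurable (PiM (K k) (\<lambda>_. unit_uniform))"
      "(\<lambda>x. score x (k + m)) \<in> borel_measurable (PiM (K k) (\<lambda>_. unit_uniform))" by auto
    show "X k \<in> borel_measurable (PiM (K k) (\<lambda>_. unit_uniform))"
      unfolding X_def[abs_def] by measurable
  qed
  moreover have "X k (restrict x (K k)) = X k x" for k x
  proof -
    have "score (restrict x (K k)) i = score x i" if "i \<in> {k, k + m}" for i
      unfolding score_def using that by (intro arg_cong[where f = Max] image_cong) (auto simp: K_def)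
    then show ?thesis by (simp add: X_def)
  qed
  ultimately have indep: "indep_vars (\<lambda>_. borel) X {1..m}" by simp
  interpret Hoeffding_ineq ?M "{1..m}" X "\<lambda>_. 0" "\<lambda>_. 1" "\<Sum>k\<in>{1..m}. expectation (X k)"
  proof unfold_locales
    show "indep_vars (\<lambda>_. borel) X {1..m}" by (rule indep)
    show "AE x in ?M. X k x \<in> {0..1}" for k by (simp add: X_def)
  qed simp_all
  let ?\<mu> = "\<Sum>k\<in>{1..m}. expectation (X k)"
  have "expectation (X k) \<le> 1 / 3" if k: "k \<in> {1..m}" for k
  proof -
    have "expectation (X k) = expectation (indicator {x \<in> space ?M. score x (k + m) < score x k})"
      by (intro Bochner_Integration.integral_cong) (auto simp: X_def indicator_def)
    also have "\<dots> = prob ({x \<in> space ?M. score x (k + m) < score x k} \<inter> space ?M)"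
      by simp
    also have "{x \<in> space ?M. score x (k + m) < score x k} \<inter> space ?M =
        {x \<in> space ?M. score x (k + m) < score x k}"
      by auto
    also have "prob {x \<in> space ?M. score x (k + m) < score x k} \<le> 1 / 3"
      using k m by (intro prob_score_less_le) auto
    finally show ?thesis .
  qed
  then have "?\<mu> \<le> (\<Sum>k\<in>{1..m}. 1 / 3)" by (rule sum_mono)
  then have \<mu>: "?\<mu> \<le> real m / 3" by simp
  \<comment> \<open>Ranks and scores are ordered alike, so this identity holds everywhere, not just
    almost surely.\<close>
  have T: "real (half_descents n (inverse_unfair_perm n x)) = (\<Sum>k\<in>{1..m}. X k x)" for x
    unfolding half_descents_eq_sum m_def[symmetric]
  proof (rule sum.cong)
    fix k assume "k \<in> {1..m}"
    then have "k \<in> {1..n}" "k + m \<in> {1..n}" using m by auto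
    then show "of_bool (inverse_unfair_perm n x (k + m) < inverse_unfair_perm n x k) = X k x"
      using rank_among_less_iff[of "k + m" n k "score x"] by (simp add: inverse_unfair_perm_def X_def)
  qed simp
  \<comment> \<open>The deviation is measured from the actual mean, which is at most
    \<open>m/3\<close>, so it is at least \<open>5m/12 - m/3 = m/12\<close>. Hoeffding's exponent is
    then at most \<open>- 2 * (m/12)^2 / m = - m/72\<close>.\<close>
  let ?\<epsilon> = "5 * real m / 12 - ?\<mu>"
  have \<epsilon>: "real m / 12 \<le> ?\<epsilon>" using \<mu> by simp
  then have "(real m / 12)\<^sup>2 \<le> ?\<epsilon>\<^sup>2" by (intro power_mono) auto
  have "prob {x \<in> space ?M. 5 * m \<le> 12 * half_descents n (inverse_unfair_perm n x)} =
      prob {x \<in> space ?M. ?\<mu> + ?\<epsilon> \<le> (\<Sum>k\<in>{1..m}. X k x)}"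
    unfolding T[symmetric] by (intro arg_cong[where f = prob] Collect_cong) auto
  also have "\<dots> \<le> exp (- 2 * ?\<epsilon>\<^sup>2 / (\<Sum>k\<in>{1..m}. (1 - 0)\<^sup>2))"
    using m \<epsilon> by (intro Hoeffding_ineq_ge) auto
  also have "\<dots> \<le> exp (- 2 * (real m / 12)\<^sup>2 / real m)"
    using m \<open>(real m / 12)\<^sup>2 \<le> ?\<epsilon>\<^sup>2\<close> by (simp add: divide_right_mono)
  also have "- 2 * (real m / 12)\<^sup>2 / real m = - real m / 72"
    using m by (simp add: power2_eq_square)
  finally show ?thesis by (simp add: m_def)
qed

section \<open>Lower bounds on the total variation distances\<close>

text \<open>The differences of probabilities are bounded by 1, so the real supremum dominates each
  of its terms and is itself at most 1.\<close>

lemma tv_dist_bounds: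
  assumes "prob_space \<mu>" "prob_space \<nu>" "A \<subseteq> S"
  shows "measure \<nu> A - measure \<mu> A \<le> tv_dist S \<mu> \<nu>" "tv_dist S \<mu> \<nu> \<le> 1"
proof -
  have le: "\<bar>measure \<mu> B - measure \<nu> B\<bar> \<le> 1" for B
    using prob_space.prob_le_1[OF assms(1), of B] prob_space.prob_le_1[OF assms(2), of B]
      measure_nonneg[of \<mu> B] measure_nonneg[of \<nu> B] by linarith
  show "tv_dist S \<mu> \<nu> \<le> 1"
    unfolding tv_dist_def using le by (intro cSUP_least) auto
  have "\<bar>measure \<mu> A - measure \<nu> A\<bar> \<le> tv_dist S \<mu> \<nu>"
    unfolding tv_dist_def using assms le by (intro cSUP_upper bdd_aboveI2[where M = 1]) auto
  then show "measure \<nu> A - measure \<mu> A \<le> tv_dist S \<mu> \<nu>" by linarith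
qed

lemma prob_space_laws:
  "prob_space (inverse_unfair_law n)" "prob_space (unfair_law n)" "prob_space (uniform_law n)"
  unfolding inverse_unfair_law_def unfair_law_def law_def uniform_law_def
  by (intro prob_space.prob_space_distr prob_space_array_measure measurable_inverse_unfair_perm
      measurable_unfair_perm measure_pmf.prob_space_axioms)+

lemma measure_law:
  assumes "f \<in> measurable M (count_space UNIV)"
  shows "measure (law M f) A = measure M {x \<in> space M. f x \<in> A}"
proof -
  have "measure (law M f) A = measure M (f -` A \<inter> space M)"
    unfolding law_def using assms by (intro measure_distr) auto
  also have "f -` A \<inter> space M = {x \<in> space M. f x \<in> A}" by auto
  finally show ?thesis .
qed

lemma sets_array_measure_perm:
  "{x \<in> space (array_measure n). P (inverse_unfair_perm n x)} \<in> sets (array_measure n)"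
proof -
  have "inverse_unfair_perm n -` {p. P p} \<inter> space (array_measure n) \<in> sets (array_measure n)"
    using measurable_inverse_unfair_perm by (rule measurable_sets) simp
  also have "inverse_unfair_perm n -` {p. P p} \<inter> space (array_measure n) =
      {x \<in> space (array_measure n). P (inverse_unfair_perm n x)}" by auto
  finally show ?thesis .
qed

text \<open>The test event is \<open>T \<ge> 5m/12\<close> inside the symmetric group. In the upper
  bound under the inverse-unfair law, dropping membership in the group only enlarges the
  event.\<close>

lemma tv_dist_inverse_unfair_ge:
  assumes "n \<ge> 2"
  shows "1 - 36 / real (n div 2) - exp (- real (n div 2) / 72)
    \<le> tv_dist (sym_group n) (inverse_unfair_law n) (uniform_law n)"
proof -
  let ?A = "{p \<in> sym_group n. 5 * (n div 2) \<le> 12 * half_descents n p}"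
  interpret prob_space "array_measure n" by (rule prob_space_array_measure)
  have "measure (inverse_unfair_law n) ?A \<le>
      prob {x \<in> space (array_measure n). 5 * (n div 2) \<le> 12 * half_descents n (inverse_unfair_perm n x)}"
    unfolding inverse_unfair_law_def measure_law[OF measurable_inverse_unfair_perm]
    by (intro finite_measure_mono sets_array_measure_perm) auto
  also have "\<dots> \<le> exp (- real (n div 2) / 72)"
    using assms by (rule prob_inverse_unfair_half_descents_ge)
  finally have "1 - 36 / real (n div 2) - exp (- real (n div 2) / 72) \<le>
      measure (uniform_law n) ?A - measure (inverse_unfair_law n) ?A"
    using prob_uniform_half_descents_ge[OF assms] by linarith
  also have "\<dots> \<le> tv_dist (sym_group n) (inverse_unfair_law n) (uniform_law n)"
    by (intro tv_dist_bounds prob_space_laws) auto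
  finally show ?thesis .
qed

text \<open>The inverse of a non-injective map is junk, so unlike for the inverse-unfair law the
  absence of ties is needed to recover the inverse-unfair permutation as \<open>inv (unfair_perm n x)\<close>.\<close>

lemma tv_dist_unfair_ge:
  assumes "n \<ge> 2"
  shows "1 - 36 / real (n div 2) - exp (- real (n div 2) / 72)
    \<le> tv_dist (sym_group n) (unfair_law n) (uniform_law n)"
proof -
  let ?A = "{p \<in> sym_group n. 5 * (n div 2) \<le> 12 * half_descents n p}"
  \<comment> \<open>The image of \<open>?A\<close> under inversion.\<close>
  let ?B = "{p \<in> sym_group n. 5 * (n div 2) \<le> 12 * half_descents n (inv p)}"
  interpret prob_space "array_measure n" by (rule prob_space_array_measure)
  have inv_inv: "inv (inv p) = p" if "p \<in> sym_group n" for p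
    using that by (simp add: sym_group_def permutes_inv_inv)
  have inv_mem: "inv p \<in> sym_group n" if "p \<in> sym_group n" for p
    using that by (simp add: sym_group_def permutes_inv)
  have "measure (unfair_law n) ?B \<le>
      prob {x \<in> space (array_measure n). 5 * (n div 2) \<le> 12 * half_descents n (inverse_unfair_perm n x)}"
    unfolding unfair_law_def measure_law[OF measurable_unfair_perm]
  proof (rule finite_measure_mono_AE)
    show "AE x in array_measure n. x \<in> {x \<in> space (array_measure n). unfair_perm n x \<in> ?B} \<longrightarrow>
        x \<in> {x \<in> space (array_measure n). 5 * (n div 2) \<le> 12 * half_descents n (inverse_unfair_perm n x)}"
      using AE_inverse_unfair_perm_in_sym_group
      by eventually_elim (simp add: unfair_perm_def inv_inv)
  qed (rule sets_array_measure_perm)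
  also have "\<dots> \<le> exp (- real (n div 2) / 72)"
    using assms by (rule prob_inverse_unfair_half_descents_ge)
  finally have unfair: "measure (unfair_law n) ?B \<le> exp (- real (n div 2) / 72)" .
  \<comment> \<open>Inversion is a bijection of the symmetric group, so the uniform law gives
    \<open>?A\<close> and \<open>?B\<close> the same probability.\<close>
  have "bij_betw inv ?A ?B"
    by (rule bij_betw_byWitness[where f' = inv]) (auto simp: inv_inv inv_mem)
  then have "card ?A = card ?B" by (rule bij_betw_same_card)
  moreover have "measure (uniform_law n) C = card C / card (sym_group n)" if "C \<subseteq> sym_group n" for C
    unfolding uniform_law_def using finite_sym_group id_in_sym_group that
    by (subst measure_pmf_of_set) (auto simp: Int_absorb1)
  ultimately have "measure (uniform_law n) ?A = measure (uniform_law n) ?B"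
    by simp
  then have "1 - 36 / real (n div 2) - exp (- real (n div 2) / 72) \<le>
      measure (uniform_law n) ?B - measure (unfair_law n) ?B"
    using prob_uniform_half_descents_ge[OF assms] unfair by linarith
  also have "\<dots> \<le> tv_dist (sym_group n) (unfair_law n) (uniform_law n)"
    by (intro tv_dist_bounds prob_space_laws) auto
  finally show ?thesis .
qed

section \<open>Passage to the limit\<close>

lemma tendsto_lower_bound_one:
  "(\<lambda>n. 1 - 36 / real (n div 2) - exp (- real (n div 2) / 72)) \<longlonglongrightarrow> 1"
proof -
  have "filterlim (\<lambda>n :: nat. n div 2) at_top at_top"
    by (rule filterlim_at_top_div_const_nat) simp
  then have "filterlim (\<lambda>n. real (n div 2)) at_top at_top"
    by (rule filterlim_compose[OF filterlim_real_sequentially])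
  moreover have "((\<lambda>t :: real. 1 - 36 / t - exp (- t / 72)) \<longlongrightarrow> 1) at_top"
    by real_asymp
  ultimately show ?thesis by (rule filterlim_compose[rotated])
qed

theorem theorem3p1:
  fixes A :: "nat \<Rightarrow> 'a measure" and \<rho> :: "nat \<Rightarrow> 'a \<Rightarrow> nat \<Rightarrow> nat"
    and B :: "nat \<Rightarrow> 'b measure" and \<gamma> :: "nat \<Rightarrow> 'b \<Rightarrow> nat \<Rightarrow> nat"
    and C :: "nat \<Rightarrow> 'c measure" and \<pi> :: "nat \<Rightarrow> 'c \<Rightarrow> nat \<Rightarrow> nat"
  assumes "\<And>n. n \<ge> 1 \<Longrightarrow> has_law (A n) (\<rho> n) (inverse_unfair_law n)"
    and "\<And>n. n \<ge> 1 \<Longrightarrow> has_law (B n) (\<gamma> n) (unfair_law n)"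
    and "\<And>n. n \<ge> 1 \<Longrightarrow> has_law (C n) (\<pi> n) (uniform_law n)"
  shows
    "(\<lambda>n. tv_dist (sym_group n) (law (A n) (\<rho> n)) (law (C n) (\<pi> n))) \<longlonglongrightarrow> 1 \<and>
    (\<lambda>n. tv_dist (sym_group n) (law (B n) (\<gamma> n)) (law (C n) (\<pi> n))) \<longlonglongrightarrow> 1"
proof
  \<comment> \<open>The lower bounds start at \<open>n = 2\<close>, where the first pair of indices
    appears; the limits only concern large \<open>n\<close>.\<close>
  have law: "law (A n) (\<rho> n) = inverse_unfair_law n" "law (B n) (\<gamma> n) = unfair_law n"
    "law (C n) (\<pi> n) = uniform_law n" if "n \<ge> 2" for n
    using assms[of n] that by (auto simp: has_law_def)
  show "(\<lambda>n. tv_dist (sym_group n) (law (A n) (\<rho> n)) (law (C n) (\<pi> n))) \<longlonglongrightarrow> 1"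
  proof (rule tendsto_sandwich[OF _ _ tendsto_lower_bound_one tendsto_const])
    show "\<forall>\<^sub>F n in sequentially. 1 - 36 / real (n div 2) - exp (- real (n div 2) / 72) \<le>
        tv_dist (sym_group n) (law (A n) (\<rho> n)) (law (C n) (\<pi> n))"
      using eventually_ge_at_top[of 2] by eventually_elim (simp only: law tv_dist_inverse_unfair_ge)
    \<comment> \<open>The upper bound comes from \<open>tv_dist_bounds\<close> with the empty set as
      the event.\<close>
    show "\<forall>\<^sub>F n in sequentially. tv_dist (sym_group n) (law (A n) (\<rho> n)) (law (C n) (\<pi> n)) \<le> 1"
      using eventually_ge_at_top[of 2]
      by eventually_elim (simp add: law tv_dist_bounds(2)[OF prob_space_laws(1,3) empty_subsetI])
  qed
  show "(\<lambda>n. tv_dist (sym_group n) (law (B n) (\<gamma> n)) (law (C n) (\<pi> n))) \<longlonglongrightarrow> 1"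
  proof (rule tendsto_sandwich[OF _ _ tendsto_lower_bound_one tendsto_const])
    show "\<forall>\<^sub>F n in sequentially. 1 - 36 / real (n div 2) - exp (- real (n div 2) / 72) \<le>
        tv_dist (sym_group n) (law (B n) (\<gamma> n)) (law (C n) (\<pi> n))"
      using eventually_ge_at_top[of 2] by eventually_elim (simp only: law tv_dist_unfair_ge)
    show "\<forall>\<^sub>F n in sequentially. tv_dist (sym_group n) (law (B n) (\<gamma> n)) (law (C n) (\<pi> n)) \<le> 1"
      using eventually_ge_at_top[of 2]
      by eventually_elim (simp add: law tv_dist_bounds(2)[OF prob_space_laws(2,3) empty_subsetI])
  qed
qed

end
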